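(* A finite diversity $(X,\delta)$ can be embedded in a Minkowski diversity with kernel equal to some simplex (that is, there are some $d$, a simplex $K \subseteq \mathbb{R}^d$ with non-empty interior and a map $\phi: X \to \mathbb{R}^d$ such that $\delta(A) = R(\phi(A),K)$ for all $A \subseteq X$) if and only if $(X,\delta)$ has negative type.
   Context: A convex body in $\mathbb{R}^d$ is a compact, convex set with non-empty interior. For a convex body $K$ in $\mathbb{R}^d$ (the kernel) and bounded $A \subseteq \mathbb{R}^d$, the generalized circumradius of $A$ with respect to $K$ is \[R(A,K) = \inf\{\lambda \ge 0 : A \subseteq \lambda K+x \mbox{ for some } x \in \mathbb{R}^d\}.\] A diversity is a pair $(X,\delta)$ where $X$ is a set and $\delta$ is a function from the finite subsets of $X$ to $\mathbb{R}_{\geq 0}$ such that, for all finite $A,B,C \subseteq X$: (D1) $\delta(A)=0$ if and only if $|A| \leq 1$; (D2) if $B \neq \emptyset$ then $\delta(A \cup C) \leq \delta(A \cup B) + \delta(B \cup C)$. It is finite if $X$ is finite. The Minkowski diversity with kernel $K$ is $(\mathbb{R}^d,\delta_K)$ with $\delta_K(A) = R(A,K)$ for finite $A \subset \mathbb{R}^d$. A finite diversity $(X,\delta)$ is of negative type if \[\sum_{\emptyset \neq A \subseteq X}\ \sum_{\emptyset \neq B \subseteq X} x_{A} x_{B}\, \delta(A \cup B) \leq 0\] for all real vectors $x = (x_A)$ indexed by the non-empty subsets of $X$ with $\sum_{A \neq \emptyset} x_A = 0$. *)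

theory Defs
  imports "HOL-Analysis.Analysis" "HOL-Library.Function_Algebras"
begin

text \<open>
  The dimension is existentially quantified in the statement, so it cannot be a type. Real
  \<open>d\<close>-space is therefore \<^term>\<open>topspace (Euclidean_space d)\<close>, the functions
  \<^typ>\<open>nat \<Rightarrow> real\<close> vanishing from index \<open>d\<close> on, with its usual topology. The pointwise
  vector space structure makes \<^const>\<open>convex\<close>, \<^const>\<open>hull\<close> and
  \<^const>\<open>affine_dependent\<close> available there.
\<close>

instantiation "fun" :: (type, real_vector) real_vector
begin

definition scaleR_fun :: "real \<Rightarrow> ('a \<Rightarrow> 'b) \<Rightarrow> 'a \<Rightarrow> 'b"
  where "scaleR_fun r f = (\<lambda>x. r *\<^sub>R f x)"

instance
  by standard (simp_all add: scaleR_fun_def fun_eq_iff scaleR_add_left scaleR_add_right)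

end

lemma scaleR_fun_apply [simp]: "(r *\<^sub>R f) x = r *\<^sub>R f x"
  by (simp add: scaleR_fun_def)

text \<open>
  Simplices of any dimension; \<^const>\<open>simplex\<close> from the library requires class
  \<^class>\<open>euclidean_space\<close>.
\<close>

definition simplex_in :: "nat \<Rightarrow> (nat \<Rightarrow> real) set \<Rightarrow> bool"
  where "simplex_in d K \<longleftrightarrow>
    (\<exists>C. finite C \<and> C \<noteq> {} \<and> C \<subseteq> topspace (Euclidean_space d) \<and>
         \<not> affine_dependent C \<and> K = convex hull C)"

text \<open>
  The set below is non-empty whenever \<open>A\<close> is a bounded subset of \<open>d\<close>-space and \<open>K\<close> has
  non-empty interior; only then is the value of the real \<^const>\<open>Inf\<close> meaningful.
\<close>

definition gen_circumradius :: "nat \<Rightarrow> (nat \<Rightarrow> real) set \<Rightarrow> (nat \<Rightarrow> real) set \<Rightarrow> real"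
  where "gen_circumradius d A K =
    Inf {l. 0 \<le> l \<and> (\<exists>x \<in> topspace (Euclidean_space d). A \<subseteq> (\<lambda>y. l *\<^sub>R y + x) ` K)}"

definition diversity :: "'a set \<Rightarrow> ('a set \<Rightarrow> real) \<Rightarrow> bool"
  where "diversity X \<delta> \<longleftrightarrow>
    (\<forall>A. finite A \<and> A \<subseteq> X \<longrightarrow> 0 \<le> \<delta> A) \<and>
    (\<forall>A. finite A \<and> A \<subseteq> X \<longrightarrow> (\<delta> A = 0 \<longleftrightarrow> card A \<le> 1)) \<and>
    (\<forall>A B C. finite A \<and> A \<subseteq> X \<and> finite B \<and> B \<subseteq> X \<and> finite C \<and> C \<subseteq> X \<and> B \<noteq> {} \<longrightarrow>
       \<delta> (A \<union> C) \<le> \<delta> (A \<union> B) + \<delta> (B \<union> C))"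

definition minkowski_diversity :: "nat \<Rightarrow> (nat \<Rightarrow> real) set \<Rightarrow> (nat \<Rightarrow> real) set \<Rightarrow> real"
  where "minkowski_diversity d K A = gen_circumradius d A K"

text \<open>Only used for finite \<open>X\<close>; otherwise the sums over subsets are \<open>0\<close> by convention.\<close>

definition negative_type :: "'a set \<Rightarrow> ('a set \<Rightarrow> real) \<Rightarrow> bool"
  where "negative_type X \<delta> \<longleftrightarrow>
    (\<forall>x :: 'a set \<Rightarrow> real. (\<Sum>A \<in> Pow X - {{}}. x A) = 0 \<longrightarrow>
       (\<Sum>A \<in> Pow X - {{}}. \<Sum>B \<in> Pow X - {{}}. x A * x B * \<delta> (A \<union> B)) \<le> 0)"

end

theory Submission
  imports Defs
begin

text \<open>
  For a simplex \<open>K\<close> with barycentric coordinates \<open>b v\<close>, the circumradius of a non-empty \<open>A\<close> is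
  \<open>1 - (\<Sum>v. Min (b v ` A))\<close>. Since minima of unions are minima of minima and the kernel
  \<open>min s t\<close> on the non-negative reals is positive semidefinite (it is the inner product of the
  indicators of \<open>{0..s}\<close> and \<open>{0..t}\<close>), embeddable diversities have negative type; the balance
  condition on \<open>x\<close> allows shifting the coordinates to be non-negative. Conversely, write
  \<open>\<delta> A = (\<Sum>V\<supseteq>A. \<mu> V)\<close> by Moebius inversion. This diagonalizes the quadratic form, so that negative
  type means \<open>\<mu> V \<le> 0\<close> for all \<open>V \<noteq> {}, X\<close>. The points \<open>\<phi> a\<close> with coordinates \<open>- \<mu> V\<close> if \<open>a \<in> V\<close>
  and \<open>0\<close> otherwise have constant coordinate sum \<open>\<mu> X\<close> because \<open>\<delta> {a} = 0\<close>, and the circumradius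
  of \<open>\<phi> ` A\<close> with respect to the standard simplex is \<open>\<delta> A\<close>.
\<close>

section \<open>The minimum kernel\<close>

lemma sum_min_kernel_nonneg:
  fixes x m :: "'i \<Rightarrow> real"
  assumes "finite S" and m: "\<And>i. i \<in> S \<Longrightarrow> 0 \<le> m i"
  shows "0 \<le> (\<Sum>i\<in>S. \<Sum>j\<in>S. x i * x j * min (m i) (m j))"
proof -
  let ?I = "\<lambda>i. indicat_real {0..m i}"
  have int: "integrable lborel (\<lambda>t. ?I i t * ?I j t)" 
    and eq: "(LINT t|lborel. ?I i t * ?I j t) = min (m i) (m j)" if "i \<in> S" "j \<in> S" for i j
  proof -
    have *: "(\<lambda>t. ?I i t * ?I j t) = indicat_real {0..min (m i) (m j)}"
      by (auto simp: indicator_def fun_eq_iff)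
    show "integrable lborel (\<lambda>t. ?I i t * ?I j t)"
      unfolding * by (simp add: integrable_indicator_iff emeasure_lborel_Icc_eq)
    show "(LINT t|lborel. ?I i t * ?I j t) = min (m i) (m j)"
      unfolding * using m that by simp
  qed
  have "(\<Sum>i\<in>S. \<Sum>j\<in>S. x i * x j * min (m i) (m j))
      = (\<Sum>i\<in>S. \<Sum>j\<in>S. (LINT t|lborel. x i * x j * (?I i t * ?I j t)))"
    by (intro sum.cong refl) (simp add: eq)
  also have "\<dots> = (LINT t|lborel. (\<Sum>i\<in>S. \<Sum>j\<in>S. x i * x j * (?I i t * ?I j t)))"
    using int by (simp add: Bochner_Integration.integral_sum)
  also have "\<dots> = (LINT t|lborel. (\<Sum>i\<in>S. x i * ?I i t)\<^sup>2)"
    by (intro Bochner_Integration.integral_cong refl)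
       (simp add: power2_eq_square sum_product mult_ac)
  also have "0 \<le> \<dots>"
    by (rule integral_nonneg_AE) simp
  finally show ?thesis .
qed

text \<open>Balanced vectors do not see constants in a kernel. This disposes of the shift that makes
  \<open>m\<close> non-negative and of the constant 1 in the circumradius formula.\<close>

lemma sum_prod_const_eq_0:
  fixes x :: "'i \<Rightarrow> real"
  assumes "sum x S = 0"
  shows "(\<Sum>i\<in>S. \<Sum>j\<in>S. x i * x j * c) = 0"
proof -
  have "(\<Sum>i\<in>S. \<Sum>j\<in>S. x i * x j * c) = sum x S * sum x S * c"
    unfolding sum_product by (simp only: sum_distrib_right)
  then show ?thesis
    using assms by simp
qed

lemma sum_min_kernel_nonneg_balanced:
  fixes x m :: "'i \<Rightarrow> real"
  assumes "finite S" and x: "sum x S = 0"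
  shows "0 \<le> (\<Sum>i\<in>S. \<Sum>j\<in>S. x i * x j * min (m i) (m j))"
proof -
  \<comment> \<open>A shift that makes every \<open>m i + c\<close> non-negative; a sum, unlike a
    maximum, is also meaningful for empty \<open>S\<close>.\<close>
  define c where "c = (\<Sum>i\<in>S. \<bar>m i\<bar>)"
  have c: "0 \<le> m i + c" if "i \<in> S" for i
    using member_le_sum[of i S "\<lambda>i. \<bar>m i\<bar>"] that assms(1) by (simp add: c_def)
  have "0 \<le> (\<Sum>i\<in>S. \<Sum>j\<in>S. x i * x j * min (m i + c) (m j + c))"
    using assms(1) c by (rule sum_min_kernel_nonneg)
  also have "\<dots> = (\<Sum>i\<in>S. \<Sum>j\<in>S. x i * x j * min (m i) (m j) + x i * x j * c)"
    by (intro sum.cong refl) (simp add: min_add_distrib_left flip: distrib_left)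
  also have "\<dots> = (\<Sum>i\<in>S. \<Sum>j\<in>S. x i * x j * min (m i) (m j))"
    using sum_prod_const_eq_0[OF x, of c] by (simp add: sum.distrib)
  finally show ?thesis .
qed

section \<open>Circumradii with respect to a simplex\<close>

lemma sum_fun_apply: "(\<Sum>i\<in>I. f i) x = (\<Sum>i\<in>I. f i x)"
  for f :: "'i \<Rightarrow> 'b \<Rightarrow> 'c::comm_monoid_add"
  by (induction I rule: infinite_finite_induct) auto

lemma zero_in_Euclidean_space: "0 \<in> topspace (Euclidean_space d)"
  by (simp add: topspace_Euclidean_space)

lemma sum_in_Euclidean_space:
  "(\<And>i. i \<in> I \<Longrightarrow> f i \<in> topspace (Euclidean_space d)) \<Longrightarrow>
    (\<Sum>i\<in>I. c i *\<^sub>R f i) \<in> topspace (Euclidean_space d)"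
  by (simp add: topspace_Euclidean_space sum_fun_apply)

text \<open>The differences \<open>f v - g v\<close> would otherwise be the coefficients of an
  affine dependence.\<close>

lemma affine_combination_unique:
  assumes "finite C" and "\<not> affine_dependent C"
    and "sum f C = sum g C" and "(\<Sum>v\<in>C. f v *\<^sub>R v) = (\<Sum>v\<in>C. g v *\<^sub>R v)" and "v \<in> C"
  shows "f v = g v"
proof -
  have "sum (\<lambda>v. f v - g v) C = 0" "(\<Sum>v\<in>C. (f v - g v) *\<^sub>R v) = 0"
    using assms(3,4) by (simp_all add: sum_subtractf scaleR_left_diff_distrib)
  then show ?thesis
    using assms(2,5) unfolding affine_dependent_explicit_finite[OF assms(1)] by force
qed

text \<open>
  In barycentric coordinates the homothets \<open>l K + x\<close> are the sets \<open>{q. \<forall>v. c v \<le> b q v}\<close>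
  with \<open>l = 1 - sum c C\<close>, so the smallest one containing \<open>A\<close> is given by the coordinatewise minima.
\<close>

lemma gen_circumradius_convex_hull:
  assumes C: "finite C" "C \<noteq> {}" "C \<subseteq> topspace (Euclidean_space d)" "\<not> affine_dependent C"
    and b1: "\<And>q. q \<in> topspace (Euclidean_space d) \<Longrightarrow> sum (b q) C = 1"
    and b2: "\<And>q. q \<in> topspace (Euclidean_space d) \<Longrightarrow> (\<Sum>v\<in>C. b q v *\<^sub>R v) = q"
    and A: "finite A" "A \<noteq> {}" "A \<subseteq> topspace (Euclidean_space d)"
  shows "gen_circumradius d A (convex hull C) = 1 - (\<Sum>v\<in>C. Min ((\<lambda>q. b q v) ` A))"
proof -
  define m where "m v = Min ((\<lambda>q. b q v) ` A)" for v
  define r where "r = 1 - sum m C"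
  define L where "L = {l. 0 \<le> l \<and>
    (\<exists>x \<in> topspace (Euclidean_space d). A \<subseteq> (\<lambda>y. l *\<^sub>R y + x) ` (convex hull C))}"
  have m_le: "m v \<le> b a v" if "a \<in> A" for a v
    unfolding m_def using A that by (intro Min_le) auto
  have m_ge: "c \<le> m v" if "\<And>a. a \<in> A \<Longrightarrow> c \<le> b a v" for c v
    unfolding m_def using A that by (subst Min_ge_iff) auto
  have "0 \<le> r"
  proof -
    obtain a where "a \<in> A" using A by blast
    then have "sum m C \<le> sum (b a) C"
      by (intro sum_mono m_le)
    then show ?thesis
      using b1 A \<open>a \<in> A\<close> by (auto simp: r_def)
  qed
  \<comment> \<open>Taking \<open>l\<close> strictly above \<open>r\<close> makes it positive, so
    that division by \<open>l\<close> is safe even when \<open>r = 0\<close>, as for a one-point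
    \<open>A\<close>. The value \<open>r\<close> itself is reached as the infimum.\<close>
  have upper: "l \<in> L" if "r < l" for l
  proof -
    \<comment> \<open>The excess \<open>l - r\<close> is shared equally among the vertices: this
      lowers the minima just enough for the sum to be \<open>1 - l\<close>.\<close>
    define c where "c v = m v - (l - r) / card C" for v
    have "card C \<noteq> 0" using C by simp
    then have "sum c C = 1 - l"
      by (simp add: c_def sum_subtractf r_def)
    have "0 < l" using that \<open>0 \<le> r\<close> by simp
    define x where "x = (\<Sum>v\<in>C. c v *\<^sub>R v)"
    have "x \<in> topspace (Euclidean_space d)"
      unfolding x_def using C by (intro sum_in_Euclidean_space) auto
    moreover have "a \<in> (\<lambda>y. l *\<^sub>R y + x) ` (convex hull C)" if "a \<in> A" for a
    proof
      define u where "u v = (b a v - c v) / l" for v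
      have aE: "a \<in> topspace (Euclidean_space d)" using A that by blast
      have "0 \<le> u v" for v
      proof -
        have "c v \<le> m v" using \<open>r < l\<close> by (simp add: c_def)
        also have "\<dots> \<le> b a v" using that by (rule m_le)
        finally show ?thesis using \<open>0 < l\<close> by (simp add: u_def)
      qed
      moreover have "sum u C = 1"
        using \<open>0 < l\<close> b1[OF aE] \<open>sum c C = 1 - l\<close>
        by (simp add: u_def sum_subtractf flip: sum_divide_distrib)
      ultimately show "(\<Sum>v\<in>C. u v *\<^sub>R v) \<in> convex hull C"
        unfolding convex_hull_finite[OF C(1)] by auto
      have "l *\<^sub>R (\<Sum>v\<in>C. u v *\<^sub>R v) = (\<Sum>v\<in>C. (b a v - c v) *\<^sub>R v)"
        using \<open>0 < l\<close> by (simp add: u_def scaleR_sum_right)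
      also have "\<dots> = a - x"
        by (simp add: scaleR_left_diff_distrib sum_subtractf b2[OF aE] x_def)
      finally show "a = l *\<^sub>R (\<Sum>v\<in>C. u v *\<^sub>R v) + x" by simp
    qed
    ultimately show ?thesis
      using \<open>0 < l\<close> unfolding L_def by (auto intro!: bexI[of _ x])
  qed
  have lower: "r \<le> l" if "l \<in> L" for l
  proof -
    obtain x where xE: "x \<in> topspace (Euclidean_space d)"
      and x: "A \<subseteq> (\<lambda>y. l *\<^sub>R y + x) ` (convex hull C)" and "0 \<le> l"
      using \<open>l \<in> L\<close> unfolding L_def by blast
    \<comment> \<open>Barycentric coordinates are affine, not linear:
      \<open>l *\<^sub>R y + x\<close> is the affine combination of \<open>y\<close>,
      \<open>x\<close> and \<open>0\<close> with weights \<open>l\<close>, \<open>1\<close> and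
      \<open>-l\<close>, hence the correction by \<open>b 0\<close>.\<close>
    define c where "c v = b x v - l * b 0 v" for v
    have "sum c C = 1 - l"
      by (simp add: c_def sum_subtractf b1 xE zero_in_Euclidean_space flip: sum_distrib_left)
    have "c v \<le> m v" if "v \<in> C" for v
    proof (rule m_ge)
      fix a assume "a \<in> A"
      then have aE: "a \<in> topspace (Euclidean_space d)" using A by blast
      obtain y where "y \<in> convex hull C" and a: "a = l *\<^sub>R y + x"
        using x \<open>a \<in> A\<close> by blast
      then obtain u where u: "\<forall>v\<in>C. 0 \<le> u v" "sum u C = 1" "(\<Sum>v\<in>C. u v *\<^sub>R v) = y"
        unfolding convex_hull_finite[OF C(1)] by blast
      have "b a v = l * u v + c v"
      proof (rule affine_combination_unique[OF C(1,4) _ _ that])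
        show "sum (b a) C = (\<Sum>v\<in>C. l * u v + c v)"
          using u b1[OF aE] \<open>sum c C = 1 - l\<close>
          by (simp add: sum.distrib flip: sum_distrib_left)
        have "(\<Sum>v\<in>C. (l * u v + c v) *\<^sub>R v)
            = l *\<^sub>R (\<Sum>v\<in>C. u v *\<^sub>R v) + (\<Sum>v\<in>C. b x v *\<^sub>R v) - l *\<^sub>R (\<Sum>v\<in>C. b 0 v *\<^sub>R v)"
          by (simp add: c_def scaleR_add_left scaleR_left_diff_distrib sum.distrib
              sum_subtractf scaleR_sum_right)
        also have "\<dots> = a"
          by (simp add: u a b2 xE zero_in_Euclidean_space)
        finally show "(\<Sum>v\<in>C. b a v *\<^sub>R v) = (\<Sum>v\<in>C. (l * u v + c v) *\<^sub>R v)"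
          using b2[OF aE] by simp
      qed
      then show "c v \<le> b a v"
        using u(1) \<open>0 \<le> l\<close> that by simp
    qed
    then have "sum c C \<le> sum m C" by (rule sum_mono)
    then show ?thesis
      using \<open>sum c C = 1 - l\<close> by (simp add: r_def)
  qed
  have "Inf L = r"
  proof (rule antisym)
    show "Inf L \<le> r"
    proof (rule dense_ge)
      fix l assume "r < l"
      then show "Inf L \<le> l"
        using upper lower by (intro cInf_lower bdd_belowI[of L r]) auto
    qed
    show "r \<le> Inf L"
      using upper[of "r + 1"] lower by (intro cInf_greatest) auto
  qed
  then show ?thesis
    by (simp add: gen_circumradius_def L_def r_def m_def)
qed

text \<open>Complements the formula with minima, which makes sense for non-empty sets only.\<close>

lemma gen_circumradius_empty: "gen_circumradius d {} K = 0"
proof -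
  have "{l::real. 0 \<le> l \<and> (\<exists>x. x \<in> topspace (Euclidean_space d))} = {0..}"
    using zero_in_Euclidean_space by blast
  then show ?thesis
    by (simp add: gen_circumradius_def Bex_def)
qed

text \<open>The line from an interior point \<open>p\<close> of \<open>K\<close> to \<open>q\<close>
  stays in \<open>K\<close> for a short while, and \<open>q\<close> is an affine combination of
  \<open>p\<close> and a second point of that segment. For a simplex \<open>K\<close> this provides
  barycentric coordinates on the whole space without counting vertices.\<close>

lemma affine_hull_eq_Euclidean_space:
  assumes "Euclidean_space d interior_of K \<noteq> {}" and q: "q \<in> topspace (Euclidean_space d)"
  shows "q \<in> affine hull K"
proof -
  obtain U p where U: "openin (Euclidean_space d) U" "p \<in> U" "U \<subseteq> K"
    using assms(1) unfolding interior_of_def by blast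
  have pE: "p \<in> topspace (Euclidean_space d)"
    using openin_subset[OF U(1)] U(2) by blast
  define f where "f t = p + t *\<^sub>R (q - p)" for t :: real
  have "continuous_on UNIV f"
    by (intro continuous_on_coordinatewise_then_product) (auto simp: f_def intro!: continuous_intros)
  moreover have "f t \<in> topspace (Euclidean_space d)" for t
    using pE q by (simp add: f_def topspace_Euclidean_space)
  ultimately have "continuous_map euclidean (Euclidean_space d) f"
    by (simp add: Euclidean_space_def continuous_map_in_subtopology euclidean_product_topology
        topspace_Euclidean_space image_subset_iff)
  then have "open {t. f t \<in> U}"
    using openin_continuous_map_preimage[OF _ U(1)] by fastforce
  moreover have "f 0 \<in> U" using U by (simp add: f_def)
  ultimately obtain e where "0 < e" and e: "\<And>t. \<bar>t\<bar> < e \<Longrightarrow> f t \<in> U"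
    unfolding open_dist by (auto simp: dist_real_def)
  have "f (e / 2) \<in> affine hull K" "p \<in> affine hull K"
    using e[of "e / 2"] \<open>0 < e\<close> U by (auto intro: hull_inc)
  then have "(1 - 2 / e) *\<^sub>R p + (2 / e) *\<^sub>R f (e / 2) \<in> affine hull K"
    by (intro mem_affine affine_affine_hull) auto
  moreover have "(1 - 2 / e) *\<^sub>R p + (2 / e) *\<^sub>R f (e / 2) = q"
    using \<open>0 < e\<close> by (simp add: f_def fun_eq_iff field_simps)
  ultimately show ?thesis by simp
qed

lemma negative_type_if_simplex_circumradius:
  assumes "finite X" and K: "simplex_in d K" "Euclidean_space d interior_of K \<noteq> {}"
    and \<phi>: "\<phi> ` X \<subseteq> topspace (Euclidean_space d)"
    and \<delta>: "\<And>A. A \<subseteq> X \<Longrightarrow> \<delta> A = gen_circumradius d (\<phi> ` A) K"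
  shows "negative_type X \<delta>"
proof -
  obtain C where C: "finite C" "C \<noteq> {}" "C \<subseteq> topspace (Euclidean_space d)"
      "\<not> affine_dependent C" and KC: "K = convex hull C"
    using K(1) unfolding simplex_in_def by blast
  have "\<exists>u. sum u C = 1 \<and> (\<Sum>v\<in>C. u v *\<^sub>R v) = q" if "q \<in> topspace (Euclidean_space d)" for q
    using affine_hull_eq_Euclidean_space[OF K(2) that] C(1) by (simp add: KC affine_hull_finite)
  then obtain b where b: "\<And>q. q \<in> topspace (Euclidean_space d) \<Longrightarrow> sum (b q) C = 1"
      "\<And>q. q \<in> topspace (Euclidean_space d) \<Longrightarrow> (\<Sum>v\<in>C. b q v *\<^sub>R v) = q"
    by metis
  let ?P = "Pow X - {{}}"
  define m where "m v A = Min ((\<lambda>a. b (\<phi> a) v) ` A)" for v A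
  have \<delta>_eq: "\<delta> A = 1 - (\<Sum>v\<in>C. m v A)" if "A \<in> ?P" for A
  proof -
    have "finite A" "A \<noteq> {}" "A \<subseteq> X"
      using that assms(1) finite_subset by auto
    moreover from this have "\<phi> ` A \<subseteq> topspace (Euclidean_space d)"
      using \<phi> by blast
    ultimately show ?thesis
      using gen_circumradius_convex_hull[OF C b, of "\<phi> ` A"]
      by (simp add: \<delta> KC m_def image_image)
  qed
  have m_Un: "m v (A \<union> B) = min (m v A) (m v B)" if "A \<in> ?P" "B \<in> ?P" for v A B
    using that finite_subset[OF _ assms(1)] by (simp add: m_def image_Un Min_Un)
  show ?thesis
    unfolding negative_type_def
  proof (intro allI impI)
    fix x :: "'a set \<Rightarrow> real" assume x: "sum x ?P = 0"
    \<comment> \<open>The form splits into the constant kernel 1, which vanishes on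
      \<open>x\<close>, minus one minimum kernel per vertex. Points outside \<open>K\<close> have
      negative coordinates, so the balanced version of the kernel lemma is the one that
      applies.\<close>
    have "(\<Sum>A\<in>?P. \<Sum>B\<in>?P. x A * x B * \<delta> (A \<union> B))
        = (\<Sum>A\<in>?P. \<Sum>B\<in>?P. x A * x B * 1 - (\<Sum>v\<in>C. x A * x B * min (m v A) (m v B)))"
    proof (intro sum.cong refl)
      fix A B assume AB: "A \<in> ?P" "B \<in> ?P"
      then have "A \<union> B \<in> ?P" by auto
      then show "x A * x B * \<delta> (A \<union> B)
          = x A * x B * 1 - (\<Sum>v\<in>C. x A * x B * min (m v A) (m v B))"
        using AB by (simp add: \<delta>_eq m_Un right_diff_distrib sum_distrib_left)
    qed
    also have "\<dots> = - (\<Sum>A\<in>?P. \<Sum>B\<in>?P. \<Sum>v\<in>C. x A * x B * min (m v A) (m v B))"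
      using sum_prod_const_eq_0[OF x, of 1] by (simp only: sum_subtractf)
    also have "(\<Sum>A\<in>?P. \<Sum>B\<in>?P. \<Sum>v\<in>C. x A * x B * min (m v A) (m v B))
        = (\<Sum>A\<in>?P. \<Sum>v\<in>C. \<Sum>B\<in>?P. x A * x B * min (m v A) (m v B))"
      by (rule sum.cong[OF refl sum.swap])
    also have "\<dots> = (\<Sum>v\<in>C. \<Sum>A\<in>?P. \<Sum>B\<in>?P. x A * x B * min (m v A) (m v B))"
      by (rule sum.swap)
    also have "- \<dots> \<le> 0"
      using sum_nonneg[of C, OF sum_min_kernel_nonneg_balanced[OF _ x]] assms(1) by simp
    finally show "(\<Sum>A\<in>?P. \<Sum>B\<in>?P. x A * x B * \<delta> (A \<union> B)) \<le> 0" .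
  qed
qed

section \<open>The standard simplex\<close>

definition unit_fun :: "nat \<Rightarrow> nat \<Rightarrow> real"
  where "unit_fun i = (\<lambda>j. if j = i then 1 else 0)"

definition std_vertices :: "nat \<Rightarrow> (nat \<Rightarrow> real) set"
  where "std_vertices d = insert 0 (unit_fun ` {..<d})"

text \<open>Coordinates are indexed by vertices, to fit the circumradius formula. The inner product
  with \<open>v\<close> extracts the right entry of \<open>q\<close> without decoding the index of
  \<open>v\<close>.\<close>

definition std_bary :: "nat \<Rightarrow> (nat \<Rightarrow> real) \<Rightarrow> (nat \<Rightarrow> real) \<Rightarrow> real"
  where "std_bary d q v = (if v = 0 then 1 - (\<Sum>i<d. q i) else (\<Sum>i<d. v i * q i))"

lemma unit_fun_neq_0: "unit_fun i \<noteq> 0"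
  by (metis unit_fun_def zero_fun_apply zero_neq_one)

lemma inj_unit_fun: "inj unit_fun"
  by (rule injI) (metis unit_fun_def zero_neq_one)

lemma sum_std_vertices: "sum f (std_vertices d) = f 0 + (\<Sum>i<d. f (unit_fun i))"
proof -
  have "0 \<notin> unit_fun ` {..<d}" using unit_fun_neq_0 by (metis imageE)
  then show ?thesis
    by (simp add: std_vertices_def sum.reindex inj_on_subset[OF inj_unit_fun])
qed

lemma std_bary_0: "std_bary d q 0 = 1 - (\<Sum>i<d. q i)"
  by (simp add: std_bary_def)

lemma std_bary_unit_fun: "i < d \<Longrightarrow> std_bary d q (unit_fun i) = q i"
  by (simp add: std_bary_def unit_fun_neq_0) (simp add: unit_fun_def if_distrib[of "\<lambda>x. x * _"] cong: if_cong)

lemma std_combination_apply: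
  "(\<Sum>v\<in>std_vertices d. u v *\<^sub>R v) j = (if j < d then u (unit_fun j) else 0)"
  by (simp add: sum_std_vertices sum_fun_apply)
     (simp add: unit_fun_def if_distrib[of "\<lambda>x. _ * x"] cong: if_cong)

lemma sum_std_bary: "sum (std_bary d q) (std_vertices d) = 1"
  by (simp add: sum_std_vertices std_bary_0 std_bary_unit_fun)

lemma std_bary_combination:
  assumes "q \<in> topspace (Euclidean_space d)"
  shows "(\<Sum>v\<in>std_vertices d. std_bary d q v *\<^sub>R v) = q"
  using assms by (auto simp: fun_eq_iff std_combination_apply std_bary_unit_fun topspace_Euclidean_space)

lemma std_vertices_props:
  shows finite_std_vertices: "finite (std_vertices d)"
    and std_vertices_nonempty: "std_vertices d \<noteq> {}"
    and std_vertices_subset: "std_vertices d \<subseteq> topspace (Euclidean_space d)"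
  by (auto simp: std_vertices_def topspace_Euclidean_space unit_fun_def)

lemma std_vertices_affine_independent: "\<not> affine_dependent (std_vertices d)"
proof
  assume "affine_dependent (std_vertices d)"
  then obtain u v where u: "sum u (std_vertices d) = 0"
      "(\<Sum>v\<in>std_vertices d. u v *\<^sub>R v) = 0" and v: "v \<in> std_vertices d" "u v \<noteq> 0"
    using finite_std_vertices by (auto simp: affine_dependent_explicit_finite)
  have *: "u (unit_fun i) = 0" if "i < d" for i
    using fun_cong[OF u(2), of i] that by (simp add: std_combination_apply)
  then have "u 0 = 0"
    using u(1) by (simp add: sum_std_vertices)
  then show False
    using v * by (auto simp: std_vertices_def)
qed

lemma simplex_in_std: "simplex_in d (convex hull (std_vertices d))"
  unfolding simplex_in_def
  by (intro exI[of _ "std_vertices d"] conjI refl std_vertices_props std_vertices_affine_independent)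

text \<open>The points whose barycentric coordinates are all positive form a relatively open subset
  of the simplex. It contains the barycentre \<open>p\<close>, whose \<open>d + 1\<close>
  coordinates are all equal.\<close>

lemma interior_std_simplex: "Euclidean_space d interior_of (convex hull (std_vertices d)) \<noteq> {}"
proof -
  let ?K = "convex hull (std_vertices d)"
  define V where "V = {q :: nat \<Rightarrow> real. (\<forall>i<d. 0 < q i) \<and> (\<Sum>i<d. q i) < 1}"
  define p where "p i = (if i < d then 1 / (d + 1) else 0 :: real)" for i
  have "V = (\<Inter>i\<in>{..<d}. {q. 0 < q i}) \<inter> {q. (\<Sum>i<d. q i) < 1}"
    by (auto simp: V_def)
  also have "open \<dots>"
    by (intro open_Int open_INT ballI open_Collect_less continuous_intros
        continuous_on_product_coordinates) auto
  finally have "openin (Euclidean_space d) (V \<inter> topspace (Euclidean_space d))"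
    by (auto simp: Euclidean_space_def euclidean_product_topology openin_subtopology
        topspace_Euclidean_space)
  moreover have "V \<inter> topspace (Euclidean_space d) \<subseteq> ?K"
  proof
    fix q assume q: "q \<in> V \<inter> topspace (Euclidean_space d)"
    then have "\<forall>v\<in>std_vertices d. 0 \<le> std_bary d q v"
      by (auto simp: std_vertices_def std_bary_0 std_bary_unit_fun V_def less_imp_le)
    then show "q \<in> ?K"
      unfolding convex_hull_finite[OF finite_std_vertices]
      using sum_std_bary std_bary_combination q by blast
  qed
  moreover have "p \<in> V \<inter> topspace (Euclidean_space d)"
    by (simp add: V_def p_def topspace_Euclidean_space)
  ultimately show ?thesis
    unfolding interior_of_def by blast
qed

section \<open>Moebius inversion over the lattice of subsets\<close>

text \<open>In a non-trivial interval of the subset lattice, sets of even and of odd size are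
  equally many. The exponent \<open>card V + card W\<close> has the parity of the difference and
  avoids subtraction on naturals.\<close>

lemma sum_alternating_interval:
  assumes "finite W" and "A \<subseteq> W"
  shows "(\<Sum>V | A \<subseteq> V \<and> V \<subseteq> W. (-1) ^ (card V + card W)) = (if A = W then 1 else 0 :: real)"
proof (cases "A = W")
  case True
  then have "{V. A \<subseteq> V \<and> V \<subseteq> W} = {W}" by auto
  then show ?thesis by (simp add: True)
next
  case False
  have fin: "finite {V. A \<subseteq> V \<and> V \<subseteq> W}"
    using assms(1) by (rule finite_subset[rotated, OF finite_Pow_iff[THEN iffD2]]) auto
  have "(\<Sum>V | A \<subseteq> V \<and> V \<subseteq> W. (-1) ^ card V) = (0::real)"
    using card_subsupersets_even_odd[of W A] assms False fin
    by (intro sum_alternating_cancels) (auto simp: conj_ac)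
  then show ?thesis
    using False by (simp add: power_add flip: sum_distrib_right)
qed

text \<open>After exchanging the sums, the coefficient of \<open>f W\<close> is an alternating sum
  over the interval from \<open>A\<close> to \<open>W\<close>, which survives only for
  \<open>W = A\<close>.\<close>

lemma moebius_supersets:
  fixes f :: "'a set \<Rightarrow> real"
  assumes "finite X" and "A \<subseteq> X"
  shows "f A = (\<Sum>V | A \<subseteq> V \<and> V \<subseteq> X. \<Sum>W | V \<subseteq> W \<and> W \<subseteq> X. (-1) ^ (card V + card W) * f W)"
proof -
  define I where "I = {V. A \<subseteq> V \<and> V \<subseteq> X}"
  have "finite I"
    unfolding I_def using assms(1) by (rule finite_subset[rotated, OF finite_Pow_iff[THEN iffD2]]) auto
  have "(\<Sum>V\<in>I. \<Sum>W | V \<subseteq> W \<and> W \<subseteq> X. (-1) ^ (card V + card W) * f W)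
      = (\<Sum>V\<in>I. \<Sum>W | W \<in> I \<and> V \<subseteq> W. (-1) ^ (card V + card W) * f W)"
    by (intro sum.cong refl) (auto simp: I_def)
  also have "\<dots> = (\<Sum>W\<in>I. \<Sum>V | V \<in> I \<and> V \<subseteq> W. (-1) ^ (card V + card W) * f W)"
    using \<open>finite I\<close> by (intro sum.swap_restrict)
  also have "\<dots> = (\<Sum>W\<in>I. if A = W then f W else 0)"
  proof (intro sum.cong refl)
    fix W assume W: "W \<in> I"
    then have "{V. V \<in> I \<and> V \<subseteq> W} = {V. A \<subseteq> V \<and> V \<subseteq> W}"
      by (auto simp: I_def)
    then show "(\<Sum>V | V \<in> I \<and> V \<subseteq> W. (-1) ^ (card V + card W) * f W) = (if A = W then f W else 0)"
      using sum_alternating_interval[of W A] W finite_subset[OF _ assms(1), of W]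
      by (simp add: I_def flip: sum_distrib_right)
  qed
  also have "\<dots> = f A"
    using \<open>finite I\<close> assms(2) by (simp add: I_def)
  finally show ?thesis by (simp add: I_def)
qed

text \<open>
  The quadratic form of \<open>\<delta>\<close> at \<open>x\<close> equals \<open>\<Sum>V. \<mu> V * (\<Sum>A\<subseteq>V. x A)\<^sup>2\<close>, and the vector
  \<open>x A = (-1)^card (A - U)\<close> on the supersets \<open>A\<close> of \<open>U\<close> leaves only the term for \<open>V = U\<close>.
\<close>

lemma negative_type_moebius_nonpos:
  fixes \<mu> :: "'a set \<Rightarrow> real"
  assumes "finite X" and "negative_type X \<delta>"
    and \<delta>: "\<And>A. A \<subseteq> X \<Longrightarrow> \<delta> A = (\<Sum>V | A \<subseteq> V \<and> V \<subseteq> X. \<mu> V)"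
    and U: "U \<subseteq> X" "U \<noteq> X" "U \<noteq> {}"
  shows "\<mu> U \<le> 0"
proof -
  let ?P = "Pow X - {{}}"
  define x :: "'a set \<Rightarrow> real" where "x A = (if U \<subseteq> A then (-1) ^ (card A + card U) else 0)" for A
  have sum_x: "(\<Sum>A | A \<in> ?P \<and> A \<subseteq> V. x A) = (if V = U then 1 else 0)" if "V \<subseteq> X" for V
  proof -
    have "finite V" using that assms(1) finite_subset by blast
    \<comment> \<open>Removing the empty set loses nothing, since every superset of the non-empty
      \<open>U\<close> is non-empty.\<close>
    have "(\<Sum>A | A \<in> ?P \<and> A \<subseteq> V. x A) = (\<Sum>A | U \<subseteq> A \<and> A \<subseteq> V. (-1) ^ (card A + card U))"
      using U that assms(1) by (intro sum.mono_neutral_cong_right) (auto simp: x_def)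
    also have "\<dots> = (-1) ^ (card V + card U) * (\<Sum>A | U \<subseteq> A \<and> A \<subseteq> V. (-1) ^ (card A + card V))"
      by (auto simp: sum_distrib_left minus_one_power_iff intro!: sum.cong split: if_splits)
    also have "\<dots> = (if V = U then 1 else 0)"
    proof (cases "U \<subseteq> V")
      case True
      then show ?thesis
        by (simp add: sum_alternating_interval[OF \<open>finite V\<close>])
    next
      case False
      then have "{A. U \<subseteq> A \<and> A \<subseteq> V} = {}" by auto
      then show ?thesis using False by (simp only: sum.empty) auto
    qed
    finally show ?thesis .
  qed
  \<comment> \<open>The case \<open>V = X\<close> of \<open>sum_x\<close> says that \<open>x\<close>
    is balanced, because \<open>U\<close> differs from \<open>X\<close>.\<close>
  have "{A. A \<in> ?P \<and> A \<subseteq> X} = ?P" by auto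
  then have "sum x ?P = 0"
    using sum_x[of X] U by simp
  then have "(\<Sum>A\<in>?P. \<Sum>B\<in>?P. x A * x B * \<delta> (A \<union> B)) \<le> 0"
    using assms(2) unfolding negative_type_def by blast
  also have "(\<Sum>A\<in>?P. \<Sum>B\<in>?P. x A * x B * \<delta> (A \<union> B))
      = (\<Sum>A\<in>?P. \<Sum>B\<in>?P. \<Sum>V\<in>Pow X. \<mu> V * ((if A \<subseteq> V then x A else 0) * (if B \<subseteq> V then x B else 0)))"
  proof (intro sum.cong refl)
    fix A B assume AB: "A \<in> ?P" "B \<in> ?P"
    have "x A * x B * \<delta> (A \<union> B) = (\<Sum>V | A \<union> B \<subseteq> V \<and> V \<subseteq> X. x A * x B * \<mu> V)"
      using AB by (simp add: \<delta> sum_distrib_left)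
    also have "\<dots> = (\<Sum>V\<in>Pow X. \<mu> V * ((if A \<subseteq> V then x A else 0) * (if B \<subseteq> V then x B else 0)))"
      using assms(1) by (intro sum.mono_neutral_cong_left) auto
    finally show "x A * x B * \<delta> (A \<union> B)
      = (\<Sum>V\<in>Pow X. \<mu> V * ((if A \<subseteq> V then x A else 0) * (if B \<subseteq> V then x B else 0)))" .
  qed
  also have "\<dots> = (\<Sum>A\<in>?P. \<Sum>V\<in>Pow X. \<Sum>B\<in>?P. \<mu> V * ((if A \<subseteq> V then x A else 0) * (if B \<subseteq> V then x B else 0)))"
    by (rule sum.cong[OF refl sum.swap])
  also have "\<dots> = (\<Sum>V\<in>Pow X. \<Sum>A\<in>?P. \<Sum>B\<in>?P. \<mu> V * ((if A \<subseteq> V then x A else 0) * (if B \<subseteq> V then x B else 0)))"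
    by (rule sum.swap)
  also have "\<dots> = (\<Sum>V\<in>Pow X. \<mu> V * ((\<Sum>A\<in>?P. if A \<subseteq> V then x A else 0) * (\<Sum>B\<in>?P. if B \<subseteq> V then x B else 0)))"
    unfolding sum_product by (simp only: sum_distrib_left)
  also have "\<dots> = (\<Sum>V\<in>Pow X. if V = U then \<mu> V else 0)"
  proof (intro sum.cong refl)
    fix V assume "V \<in> Pow X"
    then have "(\<Sum>A\<in>?P. if A \<subseteq> V then x A else 0) = (if V = U then 1 else 0)"
      using sum_x[of V] assms(1) by (subst sum.inter_filter[symmetric]) auto
    then show "\<mu> V * ((\<Sum>A\<in>?P. if A \<subseteq> V then x A else 0) * (\<Sum>B\<in>?P. if B \<subseteq> V then x B else 0))
        = (if V = U then \<mu> V else 0)" by simp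
  qed
  also have "\<dots> = \<mu> U"
    using U assms(1) by simp
  finally show ?thesis .
qed

section \<open>Embedding diversities of negative type, and the equivalence\<close>

lemma simplex_embedding_if_negative_type:
  fixes \<delta> :: "'a set \<Rightarrow> real"
  assumes "finite X" and \<delta>0: "\<delta> {} = 0" "\<And>a. a \<in> X \<Longrightarrow> \<delta> {a} = 0"
    and neg: "negative_type X \<delta>"
  obtains d and \<phi> :: "'a \<Rightarrow> nat \<Rightarrow> real"
  where "\<phi> ` X \<subseteq> topspace (Euclidean_space d)"
    and "\<And>A. A \<subseteq> X \<Longrightarrow> \<delta> A = gen_circumradius d (\<phi> ` A) (convex hull (std_vertices d))"
proof -
  define \<mu> where "\<mu> V = (\<Sum>W | V \<subseteq> W \<and> W \<subseteq> X. (-1) ^ (card V + card W) * \<delta> W)" for V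
  have \<delta>_eq: "\<delta> A = (\<Sum>V | A \<subseteq> V \<and> V \<subseteq> X. \<mu> V)" if "A \<subseteq> X" for A
    unfolding \<mu>_def using assms(1) that by (rule moebius_supersets)
  \<comment> \<open>Each set in \<open>I\<close> will be one coordinate. The sign of the Moebius
    coefficient is known exactly for these sets; \<open>{}\<close> contains no non-empty
    \<open>A\<close>, and \<open>X\<close> is accounted for by the vertex \<open>0\<close>.\<close>
  define I where "I = Pow X - {X, {}}"
  have "finite I" using assms(1) by (simp add: I_def)
  have \<mu>_nonpos: "\<mu> V \<le> 0" if "V \<in> I" for V
    using negative_type_moebius_nonpos[OF assms(1) neg \<delta>_eq] that by (auto simp: I_def)
  have \<delta>_I: "\<delta> A = \<mu> X + (\<Sum>V\<in>I. if A \<subseteq> V then \<mu> V else 0)" if "A \<subseteq> X" "A \<noteq> {}" for A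
  proof -
    have "{V. A \<subseteq> V \<and> V \<subseteq> X} = insert X {V \<in> I. A \<subseteq> V}"
      using that by (auto simp: I_def)
    moreover have "X \<notin> I" by (simp add: I_def)
    ultimately show ?thesis
      using \<open>finite I\<close> that by (simp add: \<delta>_eq sum.inter_filter)
  qed
  obtain h where h: "bij_betw h {..<card I} I"
    using ex_bij_betw_nat_finite[OF \<open>finite I\<close>] by (auto simp: atLeast0LessThan)
  define d where "d = card I"
  define \<phi> where "\<phi> a i = (if i < d \<and> a \<in> h i then - \<mu> (h i) else 0)" for a i
  have sum_I: "(\<Sum>i<d. f (h i)) = sum f I" for f :: "'a set \<Rightarrow> real"
    unfolding d_def using sum.reindex_bij_betw[OF h] .
  have \<phi>_E: "\<phi> ` X \<subseteq> topspace (Euclidean_space d)"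
    by (auto simp: topspace_Euclidean_space \<phi>_def)
  have sum_\<phi>: "(\<Sum>i<d. \<phi> a i) = \<mu> X" if "a \<in> X" for a
  proof -
    have "(\<Sum>i<d. \<phi> a i) = (\<Sum>i<d. - (if {a} \<subseteq> h i then \<mu> (h i) else 0))"
      by (intro sum.cong refl) (simp add: \<phi>_def)
    also have "\<dots> = \<mu> X"
      using \<delta>_I[of "{a}"] \<delta>0(2)[OF that] that
      by (simp add: sum_negf sum_I[of "\<lambda>V. if a \<in> V then \<mu> V else 0"])
    finally show ?thesis .
  qed
  have "\<delta> A = gen_circumradius d (\<phi> ` A) (convex hull (std_vertices d))" if A: "A \<subseteq> X" for A
  proof (cases "A = {}")
    case True
    then show ?thesis by (simp add: gen_circumradius_empty \<delta>0)
  next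
    case False
    have "finite A" using A assms(1) finite_subset by blast
    have "gen_circumradius d (\<phi> ` A) (convex hull (std_vertices d))
        = 1 - (\<Sum>v\<in>std_vertices d. Min ((\<lambda>q. std_bary d q v) ` \<phi> ` A))"
      using \<open>finite A\<close> False A \<phi>_E
      by (intro gen_circumradius_convex_hull std_vertices_props std_vertices_affine_independent
          sum_std_bary std_bary_combination) auto
    \<comment> \<open>By the constant coordinate sum, the coordinate belonging to the vertex
      \<open>0\<close> is the same for all points, so its minimum contributes
      \<open>1 - \<mu> X\<close>.\<close>
    also have "\<dots> = 1 - (Min ((\<lambda>a. 1 - \<mu> X) ` A) + (\<Sum>i<d. Min ((\<lambda>a. \<phi> a i) ` A)))"
    proof -
      have "(\<lambda>a. 1 - (\<Sum>i<d. \<phi> a i)) ` A = (\<lambda>a. 1 - \<mu> X) ` A"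
        using A sum_\<phi> by (intro image_cong) auto
      then show ?thesis
        by (simp add: sum_std_vertices std_bary_0 std_bary_unit_fun image_image)
    qed
    \<comment> \<open>Since \<open>- \<mu> (h i)\<close> is non-negative, one point of
      \<open>A\<close> outside \<open>h i\<close> pulls the minimum down to 0; otherwise the
      coordinate is constant on \<open>A\<close>.\<close>
    also have "(\<Sum>i<d. Min ((\<lambda>a. \<phi> a i) ` A)) = (\<Sum>i<d. - (if A \<subseteq> h i then \<mu> (h i) else 0))"
    proof (intro sum.cong refl)
      fix i assume i: "i \<in> {..<d}"
      then have "h i \<in> I" using h by (auto simp: d_def bij_betw_def)
      then have "\<mu> (h i) \<le> 0" by (rule \<mu>_nonpos)
      then show "Min ((\<lambda>a. \<phi> a i) ` A) = - (if A \<subseteq> h i then \<mu> (h i) else 0)"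
        using i \<open>finite A\<close> False by (intro Min_eqI) (auto simp: \<phi>_def image_iff)
    qed
    also have "\<dots> = - (\<Sum>V\<in>I. if A \<subseteq> V then \<mu> V else 0)"
      by (simp add: sum_negf sum_I[of "\<lambda>V. if A \<subseteq> V then \<mu> V else 0"])
    also have "1 - (Min ((\<lambda>a. 1 - \<mu> X) ` A) + \<dots>) = \<delta> A"
      using False \<delta>_I[OF A False] by (simp add: image_constant_conv)
    finally show ?thesis by simp
  qed
  with \<phi>_E show ?thesis by (rule that)
qed

theorem theorem17:
  fixes X :: "'a set" and \<delta> :: "'a set \<Rightarrow> real"
  assumes "finite X" and "diversity X \<delta>"
  shows "(\<exists>(d::nat) (K::(nat \<Rightarrow> real) set) (\<phi>::'a \<Rightarrow> nat \<Rightarrow> real).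
            simplex_in d K \<and> Euclidean_space d interior_of K \<noteq> {} \<and>
            \<phi> ` X \<subseteq> topspace (Euclidean_space d) \<and>
            (\<forall>A. A \<subseteq> X \<longrightarrow> \<delta> A = minkowski_diversity d K (\<phi> ` A)))
         \<longleftrightarrow> negative_type X \<delta>"
    (is "?E \<longleftrightarrow> _")
proof
  assume ?E
  then show "negative_type X \<delta>"
    unfolding minkowski_diversity_def
    using negative_type_if_simplex_circumradius[OF assms(1)] by blast
next
  assume "negative_type X \<delta>"
  have zero: "\<delta> A = 0" if "A \<subseteq> X" "finite A" "card A \<le> 1" for A
    using assms(2) that unfolding diversity_def by blast
  show ?E
  proof (rule simplex_embedding_if_negative_type[OF assms(1) _ _ \<open>negative_type X \<delta>\<close>])
    show "\<delta> {} = 0"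
      by (simp add: zero)
    show "\<delta> {a} = 0" if "a \<in> X" for a
      using that by (simp add: zero)
    fix d and \<phi> :: "'a \<Rightarrow> nat \<Rightarrow> real"
    assume "\<phi> ` X \<subseteq> topspace (Euclidean_space d)"
      and "\<And>A. A \<subseteq> X \<Longrightarrow> \<delta> A = gen_circumradius d (\<phi> ` A) (convex hull (std_vertices d))"
    with simplex_in_std interior_std_simplex show ?E
      unfolding minkowski_diversity_def
      by (intro exI[of _ d] exI[of _ "convex hull (std_vertices d)"] exI[of _ \<phi>]) simp
  qed
qed

end
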